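(* Let $F:\mathcal{C}\to\mathcal{D}$ and $G:\mathcal{D}\to\mathcal{C}$ be functors endowed with natural transformations $\eta:\mathrm{Id}_{\mathcal{C}}\to GF$ and $\epsilon:FG\to\mathrm{Id}_{\mathcal{D}}$. (1) If $G\epsilon\circ\eta G=\mathrm{Id}_G$, then there is a semifunctor $F':\mathcal{C}\to\mathcal{D}$, that acts as $F$ on objects, such that $(F',G)$ is a semiadjunction. (2) If $\epsilon F\circ F\eta=\mathrm{Id}_F$, then there is a semifunctor $G':\mathcal{D}\to\mathcal{C}$, that acts as $G$ on objects, such that $(F,G')$ is a semiadjunction.
   Context: A semifunctor is defined in the same way as a functor (it preserves sources, targets and composition) except that it need not preserve identities. For semifunctors $F,F':\mathcal{C}\to\mathcal{D}$, a natural transformation $\alpha:F\to F'$ is a family of morphisms $\alpha_C:FC\to F'C$ with $\alpha_D\circ Ff=F'f\circ\alpha_C$ for every $f:C\to D$ in $\mathcal{C}$. For a semifunctor $F$, $F\mathrm{Id}:F\to F$ denotes the natural transformation with components $F(\mathrm{Id}_C)$. A semiadjunction $(F,G,\eta,\epsilon)$ consists of semifunctors $F:\mathcal{C}\to\mathcal{D}$, $G:\mathcal{D}\to\mathcal{C}$ and natural transformations $\eta:\mathrm{Id}_{\mathcal{C}}\to GF$ (unit) and $\epsilon:FG\to\mathrm{Id}_{\mathcal{D}}$ (counit) such that $G\epsilon\circ\eta G=G\mathrm{Id}$ and $\epsilon F\circ F\eta=F\mathrm{Id}$. Saying that $(F,G)$ is a semiadjunction means that such $\eta,\epsilon$ exist.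 *)

theory Defs
  imports Main
begin

record ('o, 'a) precategory =
  Obj :: "'o set"
  Arr :: "'a set"
  Src :: "'a \<Rightarrow> 'o"
  Tgt :: "'a \<Rightarrow> 'o"
  Idn :: "'o \<Rightarrow> 'a"
  Cmp :: "'a \<Rightarrow> 'a \<Rightarrow> 'a"  (infixl "\<cdot>\<index>" 70)

text \<open>Composition is written in the usual order: \<open>g \<cdot>\<^bsub>C\<^esub> f\<close> is "first \<open>f\<close>, then \<open>g\<close>".
  It is a total function whose values on non-composable pairs are unconstrained.\<close>

definition Hom :: "('o, 'a) precategory \<Rightarrow> 'o \<Rightarrow> 'o \<Rightarrow> 'a set" where
  "Hom C X Y = {f \<in> Arr C. Src C f = X \<and> Tgt C f = Y}"

locale category =
  fixes C :: "('o, 'a) precategory" (structure)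
  assumes Src_Obj: "f \<in> Arr C \<Longrightarrow> Src C f \<in> Obj C"
    and Tgt_Obj: "f \<in> Arr C \<Longrightarrow> Tgt C f \<in> Obj C"
    and Idn_Hom: "X \<in> Obj C \<Longrightarrow> Idn C X \<in> Hom C X X"
    and Cmp_Hom: "\<lbrakk>f \<in> Hom C X Y; g \<in> Hom C Y Z\<rbrakk> \<Longrightarrow> g \<cdot> f \<in> Hom C X Z"
    and Cmp_assoc: "\<lbrakk>f \<in> Hom C W X; g \<in> Hom C X Y; h \<in> Hom C Y Z\<rbrakk> \<Longrightarrow> (h \<cdot> g) \<cdot> f = h \<cdot> (g \<cdot> f)"
    and Cmp_Idn_left: "f \<in> Hom C X Y \<Longrightarrow> Idn C Y \<cdot> f = f"
    and Cmp_Idn_right: "f \<in> Hom C X Y \<Longrightarrow> f \<cdot> Idn C X = f"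

record ('o1, 'a1, 'o2, 'a2) semifunctor_map =
  ob :: "'o1 \<Rightarrow> 'o2"
  ar :: "'a1 \<Rightarrow> 'a2"

locale semifunctor = C: category C + D: category D
  for C :: "('o1, 'a1) precategory" and D :: "('o2, 'a2) precategory" +
  fixes F :: "('o1, 'a1, 'o2, 'a2) semifunctor_map"
  assumes ob_Obj: "X \<in> Obj C \<Longrightarrow> ob F X \<in> Obj D"
    and ar_Arr: "f \<in> Arr C \<Longrightarrow> ar F f \<in> Arr D"
    and ar_Src: "f \<in> Arr C \<Longrightarrow> Src D (ar F f) = ob F (Src C f)"
    and ar_Tgt: "f \<in> Arr C \<Longrightarrow> Tgt D (ar F f) = ob F (Tgt C f)"
    and ar_Cmp: "\<lbrakk>f \<in> Hom C X Y; g \<in> Hom C Y Z\<rbrakk> \<Longrightarrow> ar F (g \<cdot>\<^bsub>C\<^esub> f) = ar F g \<cdot>\<^bsub>D\<^esub> ar F f"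

locale cat_functor = semifunctor +
  assumes ar_Idn: "X \<in> Obj C \<Longrightarrow> ar F (Idn C X) = Idn D (ob F X)"

definition id_functor :: "('o, 'a, 'o, 'a) semifunctor_map" where
  "id_functor = \<lparr>ob = (\<lambda>X. X), ar = (\<lambda>f. f)\<rparr>"

definition comp_functor ::
  "('o2, 'a2, 'o3, 'a3) semifunctor_map \<Rightarrow> ('o1, 'a1, 'o2, 'a2) semifunctor_map
    \<Rightarrow> ('o1, 'a1, 'o3, 'a3) semifunctor_map"  (infixl "\<circ>\<^sub>F" 75) where
  "G \<circ>\<^sub>F F = \<lparr>ob = (\<lambda>X. ob G (ob F X)), ar = (\<lambda>f. ar G (ar F f))\<rparr>"

locale nat_trans = F: semifunctor C D F + F': semifunctor C D F'
  for C :: "('o1, 'a1) precategory" and D :: "('o2, 'a2) precategory"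
    and F F' :: "('o1, 'a1, 'o2, 'a2) semifunctor_map" +
  fixes \<alpha> :: "'o1 \<Rightarrow> 'a2"
  assumes component: "X \<in> Obj C \<Longrightarrow> \<alpha> X \<in> Hom D (ob F X) (ob F' X)"
    and naturality: "f \<in> Hom C X Y \<Longrightarrow> \<alpha> Y \<cdot>\<^bsub>D\<^esub> ar F f = ar F' f \<cdot>\<^bsub>D\<^esub> \<alpha> X"

text \<open>A family of components is a total function, of which only the values on the objects of the
  source category \<open>C\<close> matter; equality of transformations is therefore taken on \<open>Obj C\<close>.\<close>

definition trans_eq :: "('o1, 'a1) precategory \<Rightarrow> ('o1 \<Rightarrow> 'a2) \<Rightarrow> ('o1 \<Rightarrow> 'a2) \<Rightarrow> bool" where
  "trans_eq C \<alpha> \<beta> \<longleftrightarrow> (\<forall>X\<in>Obj C. \<alpha> X = \<beta> X)"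

definition trans_comp :: "('o2, 'a2) precategory \<Rightarrow> ('o1 \<Rightarrow> 'a2) \<Rightarrow> ('o1 \<Rightarrow> 'a2) \<Rightarrow> 'o1 \<Rightarrow> 'a2" where
  "trans_comp D \<beta> \<alpha> = (\<lambda>X. \<beta> X \<cdot>\<^bsub>D\<^esub> \<alpha> X)"

text \<open>The two whiskerings, \<open>G\<alpha>\<close> and \<open>\<alpha>G\<close>.\<close>

definition whisker_left ::
  "('o2, 'a2, 'o3, 'a3) semifunctor_map \<Rightarrow> ('o1 \<Rightarrow> 'a2) \<Rightarrow> 'o1 \<Rightarrow> 'a3"  (infixr "\<lhd>" 80) where
  "G \<lhd> \<alpha> = (\<lambda>X. ar G (\<alpha> X))"

definition whisker_right ::
  "('o2 \<Rightarrow> 'a3) \<Rightarrow> ('o1, 'a1, 'o2, 'a2) semifunctor_map \<Rightarrow> 'o1 \<Rightarrow> 'a3"  (infixl "\<rhd>" 80) where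
  "\<alpha> \<rhd> G = (\<lambda>X. \<alpha> (ob G X))"

text \<open>\<open>id_trans D F\<close> is \<open>Id\<^sub>F\<close>, with components the identities of \<open>F X\<close>, whereas \<open>F \<lhd> Idn C\<close> is
  \<open>F Id\<close>, with components \<open>F (Id X)\<close>; they agree for functors but not for semifunctors.\<close>

definition id_trans ::
  "('o2, 'a2) precategory \<Rightarrow> ('o1, 'a1, 'o2, 'a2) semifunctor_map \<Rightarrow> 'o1 \<Rightarrow> 'a2" where
  "id_trans D F = (\<lambda>X. Idn D (ob F X))"

locale semiadjunction =
  F: semifunctor C D F + G: semifunctor D C G +
  unit: nat_trans C C id_functor "G \<circ>\<^sub>F F" \<eta> + counit: nat_trans D D "F \<circ>\<^sub>F G" id_functor \<epsilon>
  for C :: "('o1, 'a1) precategory" and D :: "('o2, 'a2) precategory"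
    and F :: "('o1, 'a1, 'o2, 'a2) semifunctor_map" and G :: "('o2, 'a2, 'o1, 'a1) semifunctor_map"
    and \<eta> :: "'o1 \<Rightarrow> 'a1" and \<epsilon> :: "'o2 \<Rightarrow> 'a2" +
  assumes triangle_G: "trans_eq D (trans_comp C (G \<lhd> \<epsilon>) (\<eta> \<rhd> G)) (G \<lhd> Idn D)"
    and triangle_F: "trans_eq C (trans_comp D (\<epsilon> \<rhd> F) (F \<lhd> \<eta>)) (F \<lhd> Idn C)"

definition is_semiadjunction ::
  "('o1, 'a1) precategory \<Rightarrow> ('o2, 'a2) precategory \<Rightarrow> ('o1, 'a1, 'o2, 'a2) semifunctor_map
    \<Rightarrow> ('o2, 'a2, 'o1, 'a1) semifunctor_map \<Rightarrow> bool" where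
  "is_semiadjunction C D F G \<longleftrightarrow> (\<exists>\<eta> \<epsilon>. semiadjunction C D F G \<eta> \<epsilon>)"

end

theory Submission
  imports Defs
begin

text \<open>Put \<open>e = \<epsilon>F \<circ> F\<eta> : F \<rightarrow> F\<close>. The triangle identity for \<open>G\<close> gives \<open>\<epsilon> \<circ> eG = \<epsilon>\<close> and
  \<open>Ge \<circ> \<eta> = \<eta>\<close>, and the first of these, with the naturality of \<open>e\<close> at \<open>\<eta>\<close>, makes \<open>e\<close> idempotent.
  Hence \<open>F' f = F f \<circ> e\<close> is a semifunctor with \<open>F' Id = e\<close>, and \<open>\<eta>\<close>, \<open>\<epsilon>\<close> themselves are the unit
  and counit of a semiadjunction \<open>(F', G)\<close>. The second part is the first one in the opposite
  categories, where \<open>(F, G, \<eta>, \<epsilon>)\<close> becomes \<open>(G, F, \<epsilon>, \<eta>)\<close>.\<close>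

section \<open>Functors, natural transformations and their components\<close>

lemma ob_id_functor [simp]: "ob id_functor X = X"
  and ar_id_functor [simp]: "ar id_functor f = f"
  by (simp_all add: id_functor_def)

lemma ob_comp_functor [simp]: "ob (G \<circ>\<^sub>F F) X = ob G (ob F X)"
  and ar_comp_functor [simp]: "ar (G \<circ>\<^sub>F F) f = ar G (ar F f)"
  by (simp_all add: comp_functor_def)

lemma (in semifunctor) ar_Hom: "f \<in> Hom C X Y \<Longrightarrow> ar F f \<in> Hom D (ob F X) (ob F Y)"
  by (auto simp: Hom_def ar_Arr ar_Src ar_Tgt)

text \<open>Trades the separate conditions on \<open>Arr\<close>, \<open>Src\<close> and
  \<open>Tgt\<close> for one on hom-sets. An arrow lies in the hom-set of its own source and target,
  so nothing is lost, and \<open>Hom\<close> dualizes more smoothly than \<open>Src\<close> and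
  \<open>Tgt\<close>.\<close>

lemma semifunctorI:
  assumes "category C" and "category D"
    and "\<And>X. X \<in> Obj C \<Longrightarrow> ob F X \<in> Obj D"
    and hom: "\<And>f X Y. f \<in> Hom C X Y \<Longrightarrow> ar F f \<in> Hom D (ob F X) (ob F Y)"
    and "\<And>f g X Y Z. \<lbrakk>f \<in> Hom C X Y; g \<in> Hom C Y Z\<rbrakk> \<Longrightarrow> ar F (g \<cdot>\<^bsub>C\<^esub> f) = ar F g \<cdot>\<^bsub>D\<^esub> ar F f"
  shows "semifunctor C D F"
proof -
  have "ar F f \<in> Hom D (ob F (Src C f)) (ob F (Tgt C f))" if "f \<in> Arr C" for f
    using that by (intro hom) (simp add: Hom_def)
  then show ?thesis
    using assms by (auto simp: semifunctor_def semifunctor_axioms_def Hom_def)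
qed

lemma semifunctor_id_functor: "category C \<Longrightarrow> semifunctor C C id_functor"
  by (rule semifunctorI) simp_all

lemma semifunctor_comp_functor:
  assumes "semifunctor C D F" and "semifunctor D E G"
  shows "semifunctor C E (G \<circ>\<^sub>F F)"
proof -
  interpret F: semifunctor C D F by fact
  interpret G: semifunctor D E G by fact
  show ?thesis
    by (rule semifunctorI)
      (auto simp: F.C.category_axioms G.D.category_axioms F.ob_Obj G.ob_Obj F.ar_Cmp
        intro: F.ar_Hom G.ar_Hom G.ar_Cmp)
qed

lemma (in category) Hom_Obj:
  assumes "f \<in> Hom C X Y"
  shows "X \<in> Obj C" and "Y \<in> Obj C"
  using assms Src_Obj Tgt_Obj by (auto simp: Hom_def)

section \<open>Splitting off a semifunctor\<close>

locale triangle_G_pair = F: cat_functor C D F + G: cat_functor D C G +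
  unit: nat_trans C C id_functor "G \<circ>\<^sub>F F" \<eta> + counit: nat_trans D D "F \<circ>\<^sub>F G" id_functor \<epsilon>
  for C :: "('o1, 'a1) precategory" and D :: "('o2, 'a2) precategory"
    and F :: "('o1, 'a1, 'o2, 'a2) semifunctor_map" and G :: "('o2, 'a2, 'o1, 'a1) semifunctor_map"
    and \<eta> :: "'o1 \<Rightarrow> 'a1" and \<epsilon> :: "'o2 \<Rightarrow> 'a2" +
  assumes triangle: "Y \<in> Obj D \<Longrightarrow> ar G (\<epsilon> Y) \<cdot>\<^bsub>C\<^esub> \<eta> (ob G Y) = Idn C (ob G Y)"
begin

lemma unit_Hom: "X \<in> Obj C \<Longrightarrow> \<eta> X \<in> Hom C X (ob G (ob F X))"
  using unit.component by simp

lemma counit_Hom: "Y \<in> Obj D \<Longrightarrow> \<epsilon> Y \<in> Hom D (ob F (ob G Y)) Y"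
  using counit.component by simp

lemma unit_natural: "f \<in> Hom C X Y \<Longrightarrow> \<eta> Y \<cdot>\<^bsub>C\<^esub> f = ar G (ar F f) \<cdot>\<^bsub>C\<^esub> \<eta> X"
  using unit.naturality by simp

lemma counit_natural: "g \<in> Hom D X Y \<Longrightarrow> \<epsilon> Y \<cdot>\<^bsub>D\<^esub> ar F (ar G g) = g \<cdot>\<^bsub>D\<^esub> \<epsilon> X"
  using counit.naturality by simp

text \<open>Typing rules. Composition is constrained only on composable pairs, so each reassociation
  below has hom-set premises, which are discharged by resolving with these rules repeatedly.\<close>

lemmas Homs = unit_Hom counit_Hom F.ar_Hom G.ar_Hom F.ob_Obj G.ob_Obj

text \<open>The left side of the other triangle identity, so it measures how far
  \<open>(F, G)\<close> is from being an adjunction.\<close>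

definition idem :: "'o1 \<Rightarrow> 'a2" where
  "idem X = \<epsilon> (ob F X) \<cdot>\<^bsub>D\<^esub> ar F (\<eta> X)"

lemma idem_Hom: "X \<in> Obj C \<Longrightarrow> idem X \<in> Hom D (ob F X) (ob F X)"
  unfolding idem_def by (assumption | rule F.D.Cmp_Hom Homs)+

lemma idem_natural:
  assumes f: "f \<in> Hom C X Y"
  shows "idem Y \<cdot>\<^bsub>D\<^esub> ar F f = ar F f \<cdot>\<^bsub>D\<^esub> idem X"
proof -
  note X = F.C.Hom_Obj(1)[OF f] and Y = F.C.Hom_Obj(2)[OF f]
  have "idem Y \<cdot>\<^bsub>D\<^esub> ar F f = \<epsilon> (ob F Y) \<cdot>\<^bsub>D\<^esub> (ar F (\<eta> Y) \<cdot>\<^bsub>D\<^esub> ar F f)"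
    unfolding idem_def by (rule F.D.Cmp_assoc) (rule Homs f X Y)+
  also have "ar F (\<eta> Y) \<cdot>\<^bsub>D\<^esub> ar F f = ar F (ar G (ar F f) \<cdot>\<^bsub>C\<^esub> \<eta> X)"
    using F.ar_Cmp[OF f unit_Hom[OF Y]] unit_natural[OF f] by simp
  also have "\<dots> = ar F (ar G (ar F f)) \<cdot>\<^bsub>D\<^esub> ar F (\<eta> X)"
    by (rule F.ar_Cmp) (rule Homs f X Y)+
  also have "\<epsilon> (ob F Y) \<cdot>\<^bsub>D\<^esub> \<dots> = (\<epsilon> (ob F Y) \<cdot>\<^bsub>D\<^esub> ar F (ar G (ar F f))) \<cdot>\<^bsub>D\<^esub> ar F (\<eta> X)"
    by (rule F.D.Cmp_assoc[symmetric]) (rule Homs f X Y)+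
  also have "\<dots> = (ar F f \<cdot>\<^bsub>D\<^esub> \<epsilon> (ob F X)) \<cdot>\<^bsub>D\<^esub> ar F (\<eta> X)"
    by (simp add: counit_natural[OF F.ar_Hom[OF f]])
  also have "\<dots> = ar F f \<cdot>\<^bsub>D\<^esub> idem X"
    unfolding idem_def by (rule F.D.Cmp_assoc) (rule Homs f X Y)+
  finally show ?thesis .
qed

text \<open>Naturality of \<epsilon> at its own component \<open>\<epsilon> Y\<close> turns the
  inner counit into \<open>FG(\<epsilon> Y)\<close>. This meets \<open>F(\<eta>)\<close> at
  \<open>GY\<close>, and the image under \<open>F\<close> of the triangle cancels both.\<close>

lemma counit_idem:
  assumes Y: "Y \<in> Obj D"
  shows "\<epsilon> Y \<cdot>\<^bsub>D\<^esub> idem (ob G Y) = \<epsilon> Y"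
proof -
  let ?GY = "ob G Y"
  have "\<epsilon> Y \<cdot>\<^bsub>D\<^esub> idem ?GY = (\<epsilon> Y \<cdot>\<^bsub>D\<^esub> \<epsilon> (ob F ?GY)) \<cdot>\<^bsub>D\<^esub> ar F (\<eta> ?GY)"
    unfolding idem_def by (rule F.D.Cmp_assoc[symmetric]) (rule Homs Y)+
  also have "\<dots> = (\<epsilon> Y \<cdot>\<^bsub>D\<^esub> ar F (ar G (\<epsilon> Y))) \<cdot>\<^bsub>D\<^esub> ar F (\<eta> ?GY)"
    by (simp add: counit_natural[OF counit_Hom[OF Y]])
  also have "\<dots> = \<epsilon> Y \<cdot>\<^bsub>D\<^esub> (ar F (ar G (\<epsilon> Y)) \<cdot>\<^bsub>D\<^esub> ar F (\<eta> ?GY))"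
    by (rule F.D.Cmp_assoc) (rule Homs Y)+
  also have "ar F (ar G (\<epsilon> Y)) \<cdot>\<^bsub>D\<^esub> ar F (\<eta> ?GY) = ar F (ar G (\<epsilon> Y) \<cdot>\<^bsub>C\<^esub> \<eta> ?GY)"
    by (rule F.ar_Cmp[symmetric]) (rule Homs Y)+
  also have "\<dots> = Idn D (ob F ?GY)"
    by (simp add: triangle Y F.ar_Idn Homs)
  also have "\<epsilon> Y \<cdot>\<^bsub>D\<^esub> \<dots> = \<epsilon> Y"
    by (rule F.D.Cmp_Idn_right) (rule Homs Y)+
  finally show ?thesis .
qed

text \<open>Naturality moves \<open>idem\<close> from the right of \<open>F(\<eta> X)\<close> to its
  left, where the counit absorbs it. The equation is used twice: for idempotence, and as the
  triangle identity for \<open>F'\<close>.\<close>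

lemma counit_unit_idem:
  assumes X: "X \<in> Obj C"
  shows "\<epsilon> (ob F X) \<cdot>\<^bsub>D\<^esub> (ar F (\<eta> X) \<cdot>\<^bsub>D\<^esub> idem X) = idem X"
proof -
  let ?GFX = "ob G (ob F X)"
  have "ar F (\<eta> X) \<cdot>\<^bsub>D\<^esub> idem X = idem ?GFX \<cdot>\<^bsub>D\<^esub> ar F (\<eta> X)"
    by (rule idem_natural[OF unit_Hom[OF X], symmetric])
  also have "\<epsilon> (ob F X) \<cdot>\<^bsub>D\<^esub> \<dots> = (\<epsilon> (ob F X) \<cdot>\<^bsub>D\<^esub> idem ?GFX) \<cdot>\<^bsub>D\<^esub> ar F (\<eta> X)"
    by (rule F.D.Cmp_assoc[symmetric]) (rule Homs idem_Hom X)+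
  also have "\<dots> = idem X"
    unfolding counit_idem[OF F.ob_Obj[OF X]] by (rule idem_def[symmetric])
  finally show ?thesis .
qed

lemma idem_idem:
  assumes X: "X \<in> Obj C"
  shows "idem X \<cdot>\<^bsub>D\<^esub> idem X = idem X"
proof -
  have "idem X \<cdot>\<^bsub>D\<^esub> idem X = \<epsilon> (ob F X) \<cdot>\<^bsub>D\<^esub> (ar F (\<eta> X) \<cdot>\<^bsub>D\<^esub> idem X)"
    \<comment> \<open>Only the left factor is unfolded, which leaves an instance of
      associativity.\<close>
    by (subst (1) idem_def, rule F.D.Cmp_assoc) (rule Homs idem_Hom X)+
  with counit_unit_idem[OF X] show ?thesis by simp
qed

text \<open>Counterpart of \<open>counit_idem\<close>: naturality of \<eta> at its own component
  \<open>\<eta> X\<close> produces the unit at \<open>GFX\<close>, which the triangle at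
  \<open>FX\<close> cancels against \<open>G(\<epsilon>)\<close>.\<close>

lemma idem_unit:
  assumes X: "X \<in> Obj C"
  shows "ar G (idem X) \<cdot>\<^bsub>C\<^esub> \<eta> X = \<eta> X"
proof -
  let ?FX = "ob F X" let ?GFX = "ob G ?FX"
  have "ar G (idem X) = ar G (\<epsilon> ?FX) \<cdot>\<^bsub>C\<^esub> ar G (ar F (\<eta> X))"
    unfolding idem_def by (rule G.ar_Cmp) (rule Homs X)+
  then have "ar G (idem X) \<cdot>\<^bsub>C\<^esub> \<eta> X = (ar G (\<epsilon> ?FX) \<cdot>\<^bsub>C\<^esub> ar G (ar F (\<eta> X))) \<cdot>\<^bsub>C\<^esub> \<eta> X"
    by simp
  also have "\<dots> = ar G (\<epsilon> ?FX) \<cdot>\<^bsub>C\<^esub> (ar G (ar F (\<eta> X)) \<cdot>\<^bsub>C\<^esub> \<eta> X)"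
    by (rule F.C.Cmp_assoc) (rule Homs X)+
  also have "ar G (ar F (\<eta> X)) \<cdot>\<^bsub>C\<^esub> \<eta> X = \<eta> ?GFX \<cdot>\<^bsub>C\<^esub> \<eta> X"
    by (rule unit_natural[OF unit_Hom[OF X], symmetric])
  also have "ar G (\<epsilon> ?FX) \<cdot>\<^bsub>C\<^esub> \<dots> = (ar G (\<epsilon> ?FX) \<cdot>\<^bsub>C\<^esub> \<eta> ?GFX) \<cdot>\<^bsub>C\<^esub> \<eta> X"
    by (rule F.C.Cmp_assoc[symmetric]) (rule Homs X)+
  also have "\<dots> = Idn C ?GFX \<cdot>\<^bsub>C\<^esub> \<eta> X"
    by (simp add: triangle Homs X)
  also have "\<dots> = \<eta> X"
    by (rule F.C.Cmp_Idn_left) (rule Homs X)+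
  finally show ?thesis .
qed

text \<open>The idempotent is put at the source; by \<open>idem_natural\<close>, putting it at the
  target would give the same arrow.\<close>

definition F' :: "('o1, 'a1, 'o2, 'a2) semifunctor_map" where
  "F' = \<lparr>ob = ob F, ar = (\<lambda>f. ar F f \<cdot>\<^bsub>D\<^esub> idem (Src C f))\<rparr>"

lemma ob_F' [simp]: "ob F' X = ob F X"
  by (simp add: F'_def)

lemma ar_F': "f \<in> Hom C X Y \<Longrightarrow> ar F' f = ar F f \<cdot>\<^bsub>D\<^esub> idem X"
  by (simp add: F'_def Hom_def)

lemma F'_Hom:
  assumes f: "f \<in> Hom C X Y"
  shows "ar F' f \<in> Hom D (ob F X) (ob F Y)"
  unfolding ar_F'[OF f] by (rule F.D.Cmp_Hom idem_Hom Homs f F.C.Hom_Obj(1)[OF f])+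

lemma semifunctor_F': "semifunctor C D F'"
proof (rule semifunctorI)
  show "category C" "category D" by unfold_locales
next
  fix f g X Y Z
  assume f: "f \<in> Hom C X Y" and g: "g \<in> Hom C Y Z"
  note X = F.C.Hom_Obj(1)[OF f] and Y = F.C.Hom_Obj(2)[OF f]
  have "ar F' g \<cdot>\<^bsub>D\<^esub> ar F' f = ar F g \<cdot>\<^bsub>D\<^esub> (idem Y \<cdot>\<^bsub>D\<^esub> (ar F f \<cdot>\<^bsub>D\<^esub> idem X))"
    unfolding ar_F'[OF f] ar_F'[OF g]
    by (rule F.D.Cmp_assoc) (rule F.D.Cmp_Hom idem_Hom Homs f g X Y)+
  also have "idem Y \<cdot>\<^bsub>D\<^esub> (ar F f \<cdot>\<^bsub>D\<^esub> idem X) = (idem Y \<cdot>\<^bsub>D\<^esub> ar F f) \<cdot>\<^bsub>D\<^esub> idem X"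
    by (rule F.D.Cmp_assoc[symmetric]) (rule idem_Hom Homs f X Y)+
  \<comment> \<open>The inner idempotent slides past \<open>F f\<close> to meet the outer one, and
    idempotence merges the two.\<close>
  also have "\<dots> = ar F f \<cdot>\<^bsub>D\<^esub> (idem X \<cdot>\<^bsub>D\<^esub> idem X)"
    unfolding idem_natural[OF f] by (rule F.D.Cmp_assoc) (rule idem_Hom Homs f X Y)+
  also have "idem X \<cdot>\<^bsub>D\<^esub> idem X = idem X" by (rule idem_idem[OF X])
  also have "ar F g \<cdot>\<^bsub>D\<^esub> (ar F f \<cdot>\<^bsub>D\<^esub> idem X) = (ar F g \<cdot>\<^bsub>D\<^esub> ar F f) \<cdot>\<^bsub>D\<^esub> idem X"
    by (rule F.D.Cmp_assoc[symmetric]) (rule idem_Hom Homs f g X)+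
  also have "\<dots> = ar F' (g \<cdot>\<^bsub>C\<^esub> f)"
    using ar_F'[OF F.C.Cmp_Hom[OF f g]] F.ar_Cmp[OF f g] by simp
  finally show "ar F' (g \<cdot>\<^bsub>C\<^esub> f) = ar F' g \<cdot>\<^bsub>D\<^esub> ar F' f" by simp
qed (simp_all add: F.ob_Obj F'_Hom)

lemma unit_F': "nat_trans C C id_functor (G \<circ>\<^sub>F F') \<eta>"
proof (intro nat_trans.intro nat_trans_axioms.intro)
  show "semifunctor C C id_functor"
    by (rule semifunctor_id_functor) unfold_locales
  show "semifunctor C C (G \<circ>\<^sub>F F')"
    by (rule semifunctor_comp_functor[OF semifunctor_F']) unfold_locales
next
  fix f X Y
  assume f: "f \<in> Hom C X Y"
  note X = F.C.Hom_Obj(1)[OF f]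
  have "ar G (ar F' f) \<cdot>\<^bsub>C\<^esub> \<eta> X = (ar G (ar F f) \<cdot>\<^bsub>C\<^esub> ar G (idem X)) \<cdot>\<^bsub>C\<^esub> \<eta> X"
    by (simp add: ar_F'[OF f] G.ar_Cmp[OF idem_Hom[OF X] F.ar_Hom[OF f]])
  \<comment> \<open>The extra factor \<open>G(idem X)\<close> is now next to \<eta>, which absorbs
    it.\<close>
  also have "\<dots> = ar G (ar F f) \<cdot>\<^bsub>C\<^esub> (ar G (idem X) \<cdot>\<^bsub>C\<^esub> \<eta> X)"
    by (rule F.C.Cmp_assoc) (rule idem_Hom Homs f X)+
  also have "\<dots> = \<eta> Y \<cdot>\<^bsub>C\<^esub> f"
    by (simp add: idem_unit[OF X] unit_natural[OF f])
  finally show "\<eta> Y \<cdot>\<^bsub>C\<^esub> ar id_functor f = ar (G \<circ>\<^sub>F F') f \<cdot>\<^bsub>C\<^esub> \<eta> X" by simp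
qed (simp add: unit_Hom)

lemma counit_F': "nat_trans D D (F' \<circ>\<^sub>F G) id_functor \<epsilon>"
proof (intro nat_trans.intro nat_trans_axioms.intro)
  show "semifunctor D D id_functor"
    by (rule semifunctor_id_functor) unfold_locales
  show "semifunctor D D (F' \<circ>\<^sub>F G)"
    by (rule semifunctor_comp_functor[OF _ semifunctor_F']) unfold_locales
next
  fix g X Y
  assume g: "g \<in> Hom D X Y"
  note X = F.D.Hom_Obj(1)[OF g] and Y = F.D.Hom_Obj(2)[OF g]
  let ?GX = "ob G X"
  have "\<epsilon> Y \<cdot>\<^bsub>D\<^esub> ar F' (ar G g) = (\<epsilon> Y \<cdot>\<^bsub>D\<^esub> ar F (ar G g)) \<cdot>\<^bsub>D\<^esub> idem ?GX"
    unfolding ar_F'[OF G.ar_Hom[OF g]]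
    by (rule F.D.Cmp_assoc[symmetric]) (rule idem_Hom Homs g X Y)+
  \<comment> \<open>After naturality of the original counit, the extra factor is next to \<epsilon>,
    which absorbs it.\<close>
  also have "\<dots> = g \<cdot>\<^bsub>D\<^esub> (\<epsilon> X \<cdot>\<^bsub>D\<^esub> idem ?GX)"
    unfolding counit_natural[OF g] by (rule F.D.Cmp_assoc) (rule idem_Hom Homs g X)+
  also have "\<dots> = g \<cdot>\<^bsub>D\<^esub> \<epsilon> X"
    by (simp add: counit_idem[OF X])
  finally show "\<epsilon> Y \<cdot>\<^bsub>D\<^esub> ar (F' \<circ>\<^sub>F G) g = ar id_functor g \<cdot>\<^bsub>D\<^esub> \<epsilon> X" by simp
qed (simp add: counit_Hom)

lemma semiadjunction_F': "semiadjunction C D F' G \<eta> \<epsilon>"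
proof (intro semiadjunction.intro semiadjunction_axioms.intro semifunctor_F' unit_F' counit_F')
  show "semifunctor D C G" by unfold_locales
  \<comment> \<open>Since \<open>G\<close> preserves identities, \<open>G Id\<close> is the identity
    transformation of the assumed triangle.\<close>
  show "trans_eq D (trans_comp C (G \<lhd> \<epsilon>) (\<eta> \<rhd> G)) (G \<lhd> Idn D)"
    by (simp add: trans_eq_def trans_comp_def whisker_left_def whisker_right_def triangle G.ar_Idn)
  \<comment> \<open>Here the target \<open>F' Id\<close> is \<open>idem\<close> rather than an
    identity, and this is what makes the second triangle hold.\<close>
  have "\<epsilon> (ob F X) \<cdot>\<^bsub>D\<^esub> ar F' (\<eta> X) = ar F' (Idn C X)" if X: "X \<in> Obj C" for X
  proof -
    have "ar F' (Idn C X) = idem X"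
      using F.D.Cmp_Idn_left[OF idem_Hom[OF X]] X by (simp add: ar_F'[OF F.C.Idn_Hom] F.ar_Idn)
    with X show ?thesis
      by (simp add: ar_F'[OF unit_Hom] counit_unit_idem)
  qed
  then show "trans_eq C (trans_comp D (\<epsilon> \<rhd> F') (F' \<lhd> \<eta>)) (F' \<lhd> Idn C)"
    by (simp add: trans_eq_def trans_comp_def whisker_left_def whisker_right_def)
qed

end

text \<open>Restates the construction for arbitrary categories, so that it can also be instantiated
  at opposite ones.\<close>

lemma exists_left_semiadjoint:
  fixes C :: "('o1, 'a1) precategory" and D :: "('o2, 'a2) precategory"
    and F :: "('o1, 'a1, 'o2, 'a2) semifunctor_map"
  assumes "cat_functor C D F" and "cat_functor D C G"
    and "nat_trans C C id_functor (G \<circ>\<^sub>F F) \<eta>"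
    and "nat_trans D D (F \<circ>\<^sub>F G) id_functor \<epsilon>"
    and "trans_eq D (trans_comp C (G \<lhd> \<epsilon>) (\<eta> \<rhd> G)) (id_trans C G)"
  obtains F' :: "('o1, 'a1, 'o2, 'a2) semifunctor_map"
  where "\<forall>X\<in>Obj C. ob F' X = ob F X" and "semiadjunction C D F' G \<eta> \<epsilon>"
proof -
  interpret triangle_G_pair C D F G \<eta> \<epsilon>
    using assms
    by (simp add: triangle_G_pair_def triangle_G_pair_axioms_def
        trans_eq_def trans_comp_def whisker_left_def whisker_right_def id_trans_def)
  show ?thesis
    by (rule that[of F']) (simp_all add: semiadjunction_F')
qed

section \<open>Duality\<close>

text \<open>Objects and arrows keep their types, and a \<open>semifunctor_map\<close> stores no
  category, so the same \<open>F\<close> and the same families of components serve between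
  opposites.\<close>

definition opp :: "('o, 'a) precategory \<Rightarrow> ('o, 'a) precategory" where
  "opp C = \<lparr>Obj = Obj C, Arr = Arr C, Src = Tgt C, Tgt = Src C, Idn = Idn C,
    Cmp = (\<lambda>g f. f \<cdot>\<^bsub>C\<^esub> g)\<rparr>"

lemma opp_simps [simp]:
  "Obj (opp C) = Obj C" "Idn (opp C) = Idn C" "g \<cdot>\<^bsub>opp C\<^esub> f = f \<cdot>\<^bsub>C\<^esub> g" "opp (opp C) = C"
  by (simp_all add: opp_def)

lemma Hom_opp [simp]: "Hom (opp C) X Y = Hom C Y X"
  by (auto simp: Hom_def opp_def)

lemma category_opp:
  assumes "category C"
  shows "category (opp C)"
proof -
  interpret category C by fact
  show ?thesis
  proof
    fix f assume "f \<in> Arr (opp C)"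
    then show "Src (opp C) f \<in> Obj (opp C)" "Tgt (opp C) f \<in> Obj (opp C)"
      by (simp_all add: opp_def Src_Obj Tgt_Obj)
  qed (simp_all add: Idn_Hom Cmp_Hom Cmp_assoc Cmp_Idn_left Cmp_Idn_right)
qed

lemma semifunctor_opp:
  assumes "semifunctor C D F"
  shows "semifunctor (opp C) (opp D) F"
proof -
  interpret semifunctor C D F by fact
  show ?thesis
    by (rule semifunctorI)
      (simp_all add: category_opp C.category_axioms D.category_axioms ob_Obj ar_Hom ar_Cmp)
qed

lemma cat_functor_opp:
  assumes "cat_functor C D F"
  shows "cat_functor (opp C) (opp D) F"
  using assms by (simp add: cat_functor_def cat_functor_axioms_def semifunctor_opp)

lemma nat_trans_opp:
  assumes "nat_trans C D F F' \<alpha>"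
  shows "nat_trans (opp C) (opp D) F' F \<alpha>"
  using assms by (simp add: nat_trans_def nat_trans_axioms_def semifunctor_opp)

lemma trans_eq_opp [simp]: "trans_eq (opp C) \<alpha> \<beta> \<longleftrightarrow> trans_eq C \<alpha> \<beta>"
  by (simp add: trans_eq_def)

lemma trans_comp_opp [simp]: "trans_comp (opp D) \<beta> \<alpha> = trans_comp D \<alpha> \<beta>"
  by (simp add: trans_comp_def)

lemma id_trans_opp [simp]: "id_trans (opp D) F = id_trans D F"
  by (simp add: id_trans_def)

text \<open>Reversing arrows exchanges unit with counit and one triangle with the other;
  \<open>opp (opp C) = C\<close> brings the dualized facts back to \<open>C\<close> and
  \<open>D\<close>.\<close>

lemma semiadjunction_opp:
  assumes "semiadjunction (opp D) (opp C) G F \<epsilon> \<eta>"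
  shows "semiadjunction C D F G \<eta> \<epsilon>"
proof -
  interpret semiadjunction "opp D" "opp C" G F \<epsilon> \<eta> by fact
  show ?thesis
    using semifunctor_opp[OF F.semifunctor_axioms] semifunctor_opp[OF G.semifunctor_axioms]
      nat_trans_opp[OF unit.nat_trans_axioms] nat_trans_opp[OF counit.nat_trans_axioms]
      triangle_F triangle_G
    by (simp add: semiadjunction_def semiadjunction_axioms_def)
qed

theorem lemma2p16:
  fixes C :: "('o1, 'a1) precategory" and D :: "('o2, 'a2) precategory"
    and F :: "('o1, 'a1, 'o2, 'a2) semifunctor_map" and G :: "('o2, 'a2, 'o1, 'a1) semifunctor_map"
    and \<eta> :: "'o1 \<Rightarrow> 'a1" and \<epsilon> :: "'o2 \<Rightarrow> 'a2"
  assumes "cat_functor C D F" and "cat_functor D C G"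
    and "nat_trans C C id_functor (G \<circ>\<^sub>F F) \<eta>"
    and "nat_trans D D (F \<circ>\<^sub>F G) id_functor \<epsilon>"
  shows "(trans_eq D (trans_comp C (G \<lhd> \<epsilon>) (\<eta> \<rhd> G)) (id_trans C G) \<longrightarrow>
            (\<exists>F' :: ('o1, 'a1, 'o2, 'a2) semifunctor_map. semifunctor C D F' \<and>
               (\<forall>X\<in>Obj C. ob F' X = ob F X) \<and> is_semiadjunction C D F' G)) \<and>
         (trans_eq C (trans_comp D (\<epsilon> \<rhd> F) (F \<lhd> \<eta>)) (id_trans D F) \<longrightarrow>
            (\<exists>G' :: ('o2, 'a2, 'o1, 'a1) semifunctor_map. semifunctor D C G' \<and>
               (\<forall>Y\<in>Obj D. ob G' Y = ob G Y) \<and> is_semiadjunction C D F G'))"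
proof (intro conjI impI)
  assume "trans_eq D (trans_comp C (G \<lhd> \<epsilon>) (\<eta> \<rhd> G)) (id_trans C G)"
  then obtain F' :: "('o1, 'a1, 'o2, 'a2) semifunctor_map"
    where "\<forall>X\<in>Obj C. ob F' X = ob F X" and adj: "semiadjunction C D F' G \<eta> \<epsilon>"
    using exists_left_semiadjoint[OF assms] by blast
  moreover have "semifunctor C D F'"
    using adj by (rule semiadjunction.axioms(1))
  ultimately show "\<exists>F' :: ('o1, 'a1, 'o2, 'a2) semifunctor_map. semifunctor C D F' \<and>
      (\<forall>X\<in>Obj C. ob F' X = ob F X) \<and> is_semiadjunction C D F' G"
    unfolding is_semiadjunction_def by blast
next
  assume "trans_eq C (trans_comp D (\<epsilon> \<rhd> F) (F \<lhd> \<eta>)) (id_trans D F)"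
  \<comment> \<open>Read in the opposite categories, this is the triangle hypothesis of the first
    part for \<open>(G, F, \<epsilon>, \<eta>)\<close>.\<close>
  then have "trans_eq (opp C) (trans_comp (opp D) (F \<lhd> \<eta>) (\<epsilon> \<rhd> F)) (id_trans (opp D) F)"
    by simp
  then obtain G' :: "('o2, 'a2, 'o1, 'a1) semifunctor_map"
    where "\<forall>Y\<in>Obj (opp D). ob G' Y = ob G Y"
      and op_adj: "semiadjunction (opp D) (opp C) G' F \<epsilon> \<eta>"
    using exists_left_semiadjoint[OF cat_functor_opp[OF assms(2)] cat_functor_opp[OF assms(1)]
        nat_trans_opp[OF assms(4)] nat_trans_opp[OF assms(3)]] by blast
  moreover have adj: "semiadjunction C D F G' \<eta> \<epsilon>"
    using op_adj by (rule semiadjunction_opp)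
  moreover have "semifunctor D C G'"
    using adj by (rule semiadjunction.axioms(2))
  ultimately show "\<exists>G' :: ('o2, 'a2, 'o1, 'a1) semifunctor_map. semifunctor D C G' \<and>
      (\<forall>Y\<in>Obj D. ob G' Y = ob G Y) \<and> is_semiadjunction C D F G'"
    unfolding is_semiadjunction_def by auto
qed

end
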